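(* Given a functional vset-automaton $A$ and $Y\subseteq\mathsf{Vars}(A)$, one can construct in linear time a functional vset-automaton $A_Y$ with $[\![A_Y]\!]=[\![\pi_Y(A)]\!]$.
   Context: Strings and spans. $\Sigma$ is a fixed finite alphabet with $|\Sigma|\ge 2$. A span of $\mathbf{s}=\sigma_1\cdots\sigma_\ell\in\Sigma^*$ is an expression $[i,j\rangle$ with $1\le i\le j\le \ell+1$. $\mathsf{Vars}$ is an infinite set of variables, disjoint from $\Sigma$. For finite $V\subset\mathsf{Vars}$, a $(V,\mathbf{s})$-tuple is a function from $V$ to the spans of $\mathbf{s}$; a spanner $P$ with finite variable set $\mathsf{Vars}(P)=V$ maps each $\mathbf{s}\in\Sigma^*$ to a set $P(\mathbf{s})$ of $(V,\mathbf{s})$-tuples. Ref-words. For finite $V\subset\mathsf{Vars}$ let $\Gamma_V=\{x{\vdash},\ {\dashv}x \mid x\in V\}$, disjoint from $\Sigma$. A word $\mathbf{r}\in(\Sigma\cup\Gamma_V)^*$ is valid for $V$ if for each $x\in V$ it contains exactly one $x{\vdash}$ and exactly one ${\dashv}x$, the former to the left of the latter. $\mathsf{clr}$ is the morphism erasing $\Gamma_V$ and fixing $\Sigma$. A valid $\mathbf{r}$ with $\mathsf{clr}(\mathbf{r})=\mathbf{s}$ defines the $(V,\mathbf{s})$-tuple $\mu^{\mathbf{r}}$: writing $\mathbf{r}=\mathbf{r}'_x\, x{\vdash}\,\mathbf{r}_x\,{\dashv}x\,\mathbf{r}''_x$, $\mu^{\mathbf{r}}(x)=[i,j\rangle$ with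 $i=|\mathsf{clr}(\mathbf{r}'_x)|+1$, $j=i+|\mathsf{clr}(\mathbf{r}_x)|$. Vset-automata. A vset-automaton is a tuple $A=(V,Q,q_0,q_f,\delta)$ with $\mathsf{Vars}(A)=V\subset\mathsf{Vars}$ finite, $Q$ a finite set of states, $q_0,q_f\in Q$ initial and final states, and $\delta\colon Q\times(\Sigma\cup\{\epsilon\}\cup\Gamma_V)\to 2^Q$. $\mathcal{R}(A)$ is the set of words over $\Sigma\cup\Gamma_V$ accepted by $A$ viewed as an $\epsilon$-NFA. $[\![A]\!]$ is the spanner with variables $V$ and $[\![A]\!](\mathbf{s})=\{\mu^{\mathbf{r}}\mid\mathbf{r}\in\mathcal{R}(A)\text{ valid for }V,\ \mathsf{clr}(\mathbf{r})=\mathbf{s}\}$. $A$ is functional if every word in $\mathcal{R}(A)$ is valid for $V$. Projection: $[\![\pi_Y(A)]\!]$ is the spanner with variables $Y$ and $[\![\pi_Y(A)]\!](\mathbf{s})=\{\mu|_Y\mid\mu\in[\![A]\!](\mathbf{s})\}$. Running times are in the unit-cost RAM model with machine words of size logarithmic in the input size. *)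

theory Defs
  imports Main
begin

section \<open>Spans, tuples and spanners\<close>

text \<open>The alphabet is the (finite) type \<open>'a\<close>, the set of variables is the type \<open>'v\<close>.
  The span $[i,j\rangle$ is the pair \<open>(i, j)\<close>; positions are counted from 1.\<close>

type_synonym span = "nat \<times> nat"

definition spans :: "'a list \<Rightarrow> span set" where
  "spans s = {(i, j). 1 \<le> i \<and> i \<le> j \<and> j \<le> length s + 1}"

text \<open>A \<open>(V, s)\<close>-tuple is a partial map with domain \<open>V\<close>.\<close>

type_synonym 'v tuple = "'v \<rightharpoonup> span"

definition tuples :: "'v set \<Rightarrow> 'a list \<Rightarrow> 'v tuple set" where
  "tuples V s = {\<mu>. dom \<mu> = V \<and> ran \<mu> \<subseteq> spans s}"

text \<open>A spanner carries its variable set, so that equality of spanners includes equality of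
  the variable sets even on strings (or for spanners) without any result tuple.\<close>

record ('a, 'v) spanner =
  spanner_vars :: "'v set"
  tuples_on :: "'a list \<Rightarrow> 'v tuple set"

definition project :: "'v set \<Rightarrow> ('a, 'v) spanner \<Rightarrow> ('a, 'v) spanner" where
  "project Y P = \<lparr>spanner_vars = Y, tuples_on = (\<lambda>s. (\<lambda>\<mu>. \<mu> |` Y) ` tuples_on P s)\<rparr>"


section \<open>Ref-words\<close>

datatype ('a, 'v) symbol = Letter 'a | Open 'v | Close 'v

definition var_ops :: "'v set \<Rightarrow> ('a, 'v) symbol set" where
  "var_ops V = Open ` V \<union> Close ` V"

fun clr :: "('a, 'v) symbol list \<Rightarrow> 'a list" where
  "clr [] = []"
| "clr (Letter a # r) = a # clr r"
| "clr (Open x # r) = clr r"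
| "clr (Close x # r) = clr r"

definition valid :: "'v set \<Rightarrow> ('a, 'v) symbol list \<Rightarrow> bool" where
  "valid V r \<longleftrightarrow> set r \<subseteq> range Letter \<union> var_ops V \<and>
     (\<forall>x\<in>V. count_list r (Open x) = 1 \<and> count_list r (Close x) = 1 \<and>
        (\<exists>r1 r2 r3. r = r1 @ Open x # r2 @ Close x # r3))"

text \<open>For \<open>r\<close> valid for \<open>V\<close> and \<open>x \<in> V\<close>, the description below is satisfied by exactly one
  span; see lemmas \<open>ref_span_eq\<close> and \<open>ref_tuple_in_tuples\<close>.\<close>

definition ref_span :: "('a, 'v) symbol list \<Rightarrow> 'v \<Rightarrow> span" where
  "ref_span r x = (THE (i, j). \<exists>r1 r2 r3. r = r1 @ Open x # r2 @ Close x # r3 \<and>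
     i = length (clr r1) + 1 \<and> j = i + length (clr r2))"

definition ref_tuple :: "'v set \<Rightarrow> ('a, 'v) symbol list \<Rightarrow> 'v tuple" where
  "ref_tuple V r = (\<lambda>x. if x \<in> V then Some (ref_span r x) else None)"

lemma clr_append: "clr (r @ r') = clr r @ clr r'"
  by (induction r rule: clr.induct) auto

lemma ref_span_eq:
  assumes "count_list r (Open x) = 1" and "count_list r (Close x) = 1"
    and r: "r = r1 @ Open x # r2 @ Close x # r3"
  shows "ref_span r x = (length (clr r1) + 1, length (clr r1) + 1 + length (clr r2))"
proof -
  have o1: "Open x \<notin> set r1" "Open x \<notin> set (r2 @ Close x # r3)"
    using assms by (auto simp: count_list_0_iff)
  have c1: "Close x \<notin> set r2" "Close x \<notin> set r3"
    using assms by (auto simp: count_list_0_iff)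
  have uniq: "s1 = r1 \<and> s2 = r2" if s: "r = s1 @ Open x # s2 @ Close x # s3" for s1 s2 s3
  proof -
    have eq: "s1 @ Open x # (s2 @ Close x # s3) = r1 @ Open x # (r2 @ Close x # r3)"
      using r s by simp
    then have 1: "s1 = r1 \<and> s2 @ Close x # s3 = r2 @ Close x # r3"
      using o1 by (metis append_Cons_eq_iff)
    then have "s2 = r2"
      using c1 by (metis append_Cons_eq_iff)
    with 1 show ?thesis by simp
  qed
  show ?thesis
    unfolding ref_span_def
  proof (rule the_equality, goal_cases)
    case 1
    show ?case using r by auto
  next
    case (2 p)
    then show ?case by (auto dest: uniq)
  qed
qed

lemma ref_tuple_in_tuples:
  assumes "valid V r"
  shows "ref_tuple V r \<in> tuples V (clr r)"
proof -
  have "ref_span r x \<in> spans (clr r)" if x: "x \<in> V" for x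
  proof -
    from assms x obtain r1 r2 r3 where r: "r = r1 @ Open x # r2 @ Close x # r3"
      and c: "count_list r (Open x) = 1" "count_list r (Close x) = 1"
      unfolding valid_def by blast
    have "length (clr r) = length (clr r1) + length (clr r2) + length (clr r3)"
      by (simp add: r clr_append)
    then show ?thesis
      using ref_span_eq[OF c r] by (simp add: spans_def)
  qed
  then have "ran (ref_tuple V r) \<subseteq> spans (clr r)"
    by (auto simp: ref_tuple_def ran_def simp del: split_paired_All) metis
  moreover have "dom (ref_tuple V r) = V"
    by (simp add: ref_tuple_def dom_def)
  ultimately show ?thesis
    by (simp add: tuples_def)
qed


section \<open>Vset-automata\<close>

text \<open>\<open>None\<close> is the label of an \<open>\<epsilon>\<close>-transition.\<close>

record ('q, 'a, 'v) vsa =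
  vars :: "'v set"
  states :: "'q set"
  init :: 'q
  final :: 'q
  delta :: "'q \<Rightarrow> ('a, 'v) symbol option \<Rightarrow> 'q set"

definition labels :: "'v set \<Rightarrow> ('a, 'v) symbol option set" where
  "labels V = insert None (Some ` (range Letter \<union> var_ops V))"

definition vset_automaton :: "('q, 'a, 'v) vsa \<Rightarrow> bool" where
  "vset_automaton A \<longleftrightarrow> finite (vars A) \<and> finite (states A) \<and>
     init A \<in> states A \<and> final A \<in> states A \<and>
     (\<forall>q\<in>states A. \<forall>l\<in>labels (vars A). delta A q l \<subseteq> states A)"

text \<open>The values of \<open>delta\<close> outside \<open>states A \<times> labels (vars A)\<close> are irrelevant.\<close>

definition transitions :: "('q, 'a, 'v) vsa \<Rightarrow> ('q \<times> ('a, 'v) symbol option \<times> 'q) set" where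
  "transitions A = {(q, l, q'). q \<in> states A \<and> l \<in> labels (vars A) \<and> q' \<in> delta A q l}"

inductive path :: "('q, 'a, 'v) vsa \<Rightarrow> 'q \<Rightarrow> ('a, 'v) symbol list \<Rightarrow> 'q \<Rightarrow> bool"
  for A :: "('q, 'a, 'v) vsa" where
  path_refl: "path A q [] q"
| path_eps: "(q, None, p) \<in> transitions A \<Longrightarrow> path A p r q' \<Longrightarrow> path A q r q'"
| path_sym: "(q, Some \<gamma>, p) \<in> transitions A \<Longrightarrow> path A p r q' \<Longrightarrow> path A q (\<gamma> # r) q'"

definition ref_words :: "('q, 'a, 'v) vsa \<Rightarrow> ('a, 'v) symbol list set" where
  "ref_words A = {r. path A (init A) r (final A)}"

definition spanner_of :: "('q, 'a, 'v) vsa \<Rightarrow> ('a, 'v) spanner" where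
  "spanner_of A = \<lparr>spanner_vars = vars A,
     tuples_on = (\<lambda>s. {ref_tuple (vars A) r | r. r \<in> ref_words A \<and> valid (vars A) r \<and> clr r = s})\<rparr>"

definition functional :: "('q, 'a, 'v) vsa \<Rightarrow> bool" where
  "functional A \<longleftrightarrow> (\<forall>r\<in>ref_words A. valid (vars A) r)"


section \<open>Random access machines\<close>

text \<open>The instruction set is that of Cook and Reckhow (Time bounded random access machines,
  1973), over natural numbers with truncated subtraction. There is a one-way read-only input
  tape and a write-only output tape; each tape cell and each memory cell holds one machine
  word. Static operands are memory addresses. Multiplication and division are not primitive,
  so an upper time bound for this machine also holds for machines that have them.\<close>

datatype instr =
    Const nat nat       \<comment> \<open>\<open>Const i c\<close>: \<open>m i := c\<close>\<close>
  | Add nat nat nat     \<comment> \<open>\<open>Add i j k\<close>: \<open>m i := m j + m k\<close>\<close>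
  | Sub nat nat nat     \<comment> \<open>\<open>Sub i j k\<close>: \<open>m i := m j - m k\<close>\<close>
  | Load nat nat        \<comment> \<open>\<open>Load i j\<close>: \<open>m i := m (m j)\<close>\<close>
  | Store nat nat       \<comment> \<open>\<open>Store i j\<close>: \<open>m (m i) := m j\<close>\<close>
  | JumpPos nat nat     \<comment> \<open>\<open>JumpPos j l\<close>: continue with instruction \<open>l\<close> if \<open>m j > 0\<close>\<close>
  | Read nat
  | Write nat

type_synonym program = "instr list"

record config =
  pc :: nat
  mem :: "nat \<Rightarrow> nat"
  inp :: "nat list"
  out :: "nat list"

text \<open>Machine words are the numbers below \<open>B\<close>. A result that is not a word does not wrap
  around but makes the machine fail (\<open>None\<close>); so does reading beyond the end of the input.\<close>

definition assign :: "nat \<Rightarrow> nat \<Rightarrow> nat \<Rightarrow> config \<Rightarrow> config option" where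
  "assign B i v c =
     (if v < B then Some (c\<lparr>pc := pc c + 1, mem := (mem c)(i := v)\<rparr>) else None)"

fun exec :: "nat \<Rightarrow> instr \<Rightarrow> config \<Rightarrow> config option" where
  "exec B (Const i v) c = assign B i v c"
| "exec B (Add i j k) c = assign B i (mem c j + mem c k) c"
| "exec B (Sub i j k) c = assign B i (mem c j - mem c k) c"
| "exec B (Load i j) c = assign B i (mem c (mem c j)) c"
| "exec B (Store i j) c = assign B (mem c i) (mem c j) c"
| "exec B (JumpPos j l) c = Some (c\<lparr>pc := (if mem c j > 0 then l else pc c + 1)\<rparr>)"
| "exec B (Read i) c =
     (case inp c of [] \<Rightarrow> None | w # ws \<Rightarrow> assign B i w (c\<lparr>inp := ws\<rparr>))"
| "exec B (Write j) c = Some (c\<lparr>pc := pc c + 1, out := out c @ [mem c j]\<rparr>)"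

definition halted :: "program \<Rightarrow> config \<Rightarrow> bool" where
  "halted p c \<longleftrightarrow> pc c \<ge> length p"

fun run :: "nat \<Rightarrow> program \<Rightarrow> nat \<Rightarrow> config \<Rightarrow> config option" where
  "run B p 0 c = Some c"
| "run B p (Suc t) c =
     (if halted p c then None else Option.bind (exec B (p ! pc c) c) (run B p t))"

definition start :: "nat list \<Rightarrow> config" where
  "start x = \<lparr>pc = 0, mem = (\<lambda>_. 0), inp = x, out = []\<rparr>"

definition computes :: "nat \<Rightarrow> program \<Rightarrow> nat list \<Rightarrow> nat \<Rightarrow> nat list \<Rightarrow> bool" where
  "computes B p x t y \<longleftrightarrow> (\<exists>c. run B p t (start x) = Some c \<and> halted p c \<and> out c = y)"

text \<open>On inputs of \<open>n\<close> words, a machine word has \<open>k * log 2 (n + 2)\<close> bits.\<close>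

definition word_bound :: "nat \<Rightarrow> nat \<Rightarrow> nat" where
  "word_bound k n = (n + 2) ^ k"


section \<open>Automata as machine inputs and outputs\<close>

text \<open>States, variables and letters are represented by one word each, by means of the namings
  \<open>cq\<close>, \<open>cv\<close> and \<open>ca\<close>. A finite set is represented by any list of its elements, in
  any order and possibly with repetitions, preceded by the length of the list. The size of an
  automaton is thus linear in the numbers of its variables, states and transitions.\<close>

fun label_code :: "('v \<Rightarrow> nat) \<Rightarrow> ('a \<Rightarrow> nat) \<Rightarrow> ('a, 'v) symbol option \<Rightarrow> nat list" where
  "label_code cv ca None = [0, 0]"
| "label_code cv ca (Some (Letter a)) = [1, ca a]"
| "label_code cv ca (Some (Open x)) = [2, cv x]"
| "label_code cv ca (Some (Close x)) = [3, cv x]"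

fun transition_code :: "('q \<Rightarrow> nat) \<Rightarrow> ('v \<Rightarrow> nat) \<Rightarrow> ('a \<Rightarrow> nat) \<Rightarrow>
    'q \<times> ('a, 'v) symbol option \<times> 'q \<Rightarrow> nat list" where
  "transition_code cq cv ca (q, l, q') = [cq q] @ label_code cv ca l @ [cq q']"

definition set_code :: "('b \<Rightarrow> nat list) \<Rightarrow> 'b set \<Rightarrow> nat list set" where
  "set_code code S = {length xs # concat (map code xs) | xs. set xs = S}"

definition vsa_code :: "('q \<Rightarrow> nat) \<Rightarrow> ('v \<Rightarrow> nat) \<Rightarrow> ('a \<Rightarrow> nat) \<Rightarrow>
    ('q, 'a, 'v) vsa \<Rightarrow> nat list set" where
  "vsa_code cq cv ca A = {vs @ qs @ [cq (init A), cq (final A)] @ ts | vs qs ts.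
     vs \<in> set_code (\<lambda>x. [cv x]) (vars A) \<and>
     qs \<in> set_code (\<lambda>q. [cq q]) (states A) \<and>
     ts \<in> set_code (transition_code cq cv ca) (transitions A)}"

definition projection_input_code :: "('q \<Rightarrow> nat) \<Rightarrow> ('v \<Rightarrow> nat) \<Rightarrow> ('a \<Rightarrow> nat) \<Rightarrow>
    ('q, 'a, 'v) vsa \<Rightarrow> 'v set \<Rightarrow> nat list set" where
  "projection_input_code cq cv ca A Y =
     {ys @ w | ys w. ys \<in> set_code (\<lambda>x. [cv x]) Y \<and> w \<in> vsa_code cq cv ca A}"

end

theory Submission
  imports Defs
begin

text \<open>Relabelling every transition that operates on a variable outside \<open>Y\<close> as an
  \<open>\<epsilon>\<close>-transition deletes the operations of those variables from the accepted ref-words. This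
  preserves validity and the spans of the variables in \<open>Y\<close>, because deleting variable operations
  does not change \<open>clr\<close>. A random access machine performs the relabelling in one pass over the
  input: it reads \<open>Y\<close> first and marks its members in a table indexed by the codes of the
  variables. These codes are polynomial in the input length and the memory is initially zero, so
  the table needs no initialization.\<close>

section \<open>Restriction of ref-words\<close>

definition symbols :: "'v set \<Rightarrow> ('a, 'v) symbol set" where
  "symbols Y = range Letter \<union> var_ops Y"

definition restrict_word :: "'v set \<Rightarrow> ('a, 'v) symbol list \<Rightarrow> ('a, 'v) symbol list" where
  "restrict_word Y = filter (\<lambda>\<gamma>. \<gamma> \<in> symbols Y)"

lemma in_symbols [simp]:
  "Letter a \<in> symbols Y" "Open x \<in> symbols Y \<longleftrightarrow> x \<in> Y" "Close x \<in> symbols Y \<longleftrightarrow> x \<in> Y"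
  by (auto simp: symbols_def var_ops_def)

lemma clr_restrict_word [simp]: "clr (restrict_word Y r) = clr r"
  unfolding restrict_word_def by (induction r rule: clr.induct) auto

lemma count_list_restrict_word:
  "\<gamma> \<in> symbols Y \<Longrightarrow> count_list (restrict_word Y r) \<gamma> = count_list r \<gamma>"
  unfolding restrict_word_def by (induction r) auto

text \<open>Serves twice: it gives the decomposition that \<open>valid\<close> asks for and, through
  \<open>ref_span_eq\<close>, the span of \<open>x\<close>.\<close>

lemma restrict_word_split:
  assumes "x \<in> Y"
  shows "restrict_word Y (r1 @ Open x # r2 @ Close x # r3) =
    restrict_word Y r1 @ Open x # restrict_word Y r2 @ Close x # restrict_word Y r3"
  using assms unfolding restrict_word_def by simp

lemma valid_restrict_word:
  assumes "valid V r" and "Y \<subseteq> V"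
  shows "valid Y (restrict_word Y r)"
  unfolding valid_def
proof (intro conjI ballI)
  show "set (restrict_word Y r) \<subseteq> range Letter \<union> var_ops Y"
    by (auto simp: restrict_word_def symbols_def)
next
  fix x assume x: "x \<in> Y"
  with assms obtain r1 r2 r3 where r: "r = r1 @ Open x # r2 @ Close x # r3"
    unfolding valid_def by blast
  show "\<exists>r1 r2 r3. restrict_word Y r = r1 @ Open x # r2 @ Close x # r3"
    using restrict_word_split[OF x] r by blast
  show "count_list (restrict_word Y r) (Open x) = 1" "count_list (restrict_word Y r) (Close x) = 1"
    using assms x by (auto simp: valid_def count_list_restrict_word)
qed

lemma ref_tuple_restrict_word:
  assumes "valid V r" and "Y \<subseteq> V"
  shows "ref_tuple Y (restrict_word Y r) = ref_tuple V r |` Y"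
proof
  fix x
  show "ref_tuple Y (restrict_word Y r) x = (ref_tuple V r |` Y) x"
  proof (cases "x \<in> Y")
    case x: True
    with assms obtain r1 r2 r3 where r: "r = r1 @ Open x # r2 @ Close x # r3"
      and count: "count_list r (Open x) = 1" "count_list r (Close x) = 1"
      unfolding valid_def by blast
    have count': "count_list (restrict_word Y r) (Open x) = 1"
        "count_list (restrict_word Y r) (Close x) = 1"
      using x count by (simp_all add: count_list_restrict_word)
    have "ref_span (restrict_word Y r) x = ref_span r x"
      using ref_span_eq[OF count' restrict_word_split[OF x, of r1 r2 r3, folded r]]
        ref_span_eq[OF count r] by simp
    with x assms(2) show ?thesis
      by (auto simp: ref_tuple_def)
  qed (simp add: ref_tuple_def)
qed

section \<open>Projection of automata\<close>

definition erase :: "'v set \<Rightarrow> ('a, 'v) symbol option \<Rightarrow> ('a, 'v) symbol option" where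
  "erase Y l = Option.bind l (\<lambda>\<gamma>. if \<gamma> \<in> symbols Y then Some \<gamma> else None)"

text \<open>Going through \<open>transitions A\<close> keeps out the irrelevant values of
  \<open>delta A\<close>; the quantifier over \<open>l'\<close> merges labels that
  \<open>erase\<close> identifies.\<close>

definition project_vsa :: "'v set \<Rightarrow> ('q, 'a, 'v) vsa \<Rightarrow> ('q, 'a, 'v) vsa" where
  "project_vsa Y A = \<lparr>vars = Y, states = states A, init = init A, final = final A,
     delta = \<lambda>q l. {q'. \<exists>l'. (q, l', q') \<in> transitions A \<and> l = erase Y l'}\<rparr>"

lemma project_vsa_simps [simp]:
  "vars (project_vsa Y A) = Y" "states (project_vsa Y A) = states A"
  "init (project_vsa Y A) = init A" "final (project_vsa Y A) = final A"
  by (simp_all add: project_vsa_def)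

lemma erase_in_labels: "erase Y l \<in> labels Y"
  by (cases l) (auto simp: erase_def labels_def symbols_def)

text \<open>The side conditions in \<open>transitions\<close> hold automatically, as
  \<open>erase Y l\<close> always lies in \<open>labels Y\<close>. An image is what one pass over a
  list of transitions computes.\<close>

lemma transitions_project_vsa:
  "transitions (project_vsa Y A) = (\<lambda>(q, l, q'). (q, erase Y l, q')) ` transitions A"
proof -
  have "q \<in> states A" if "(q, l, q') \<in> transitions A" for q l q'
    using that by (simp add: transitions_def)
  then show ?thesis
    by (subst (1) transitions_def)
      (force simp: project_vsa_def erase_in_labels)
qed

lemma vset_automaton_project_vsa:
  assumes "vset_automaton A" and "Y \<subseteq> vars A"
  shows "vset_automaton (project_vsa Y A)"
proof -
  have "q' \<in> states A" if "(q, l, q') \<in> transitions A" for q l q'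
    using that assms(1) by (auto simp: transitions_def vset_automaton_def)
  then show ?thesis
    using assms by (auto simp: vset_automaton_def project_vsa_def intro: finite_subset)
qed

lemma path_project_vsa:
  assumes "path A q r p"
  shows "path (project_vsa Y A) q (restrict_word Y r) p"
  using assms
proof induction
  case (path_eps q p r q')
  from path_eps.hyps(1) have "(q, None, p) \<in> transitions (project_vsa Y A)"
    by (force simp: transitions_project_vsa erase_def)
  with path_eps.IH show ?case by (rule path.path_eps[rotated])
next
  case (path_sym q \<gamma> p r q')
  from path_sym.hyps(1) have tr: "(q, erase Y (Some \<gamma>), p) \<in> transitions (project_vsa Y A)"
    by (force simp: transitions_project_vsa)
  show ?case
  proof (cases "\<gamma> \<in> symbols Y")
    case True
    with tr path_sym.IH show ?thesis
      by (simp add: erase_def restrict_word_def path.path_sym)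
  next
    case False
    with tr path_sym.IH show ?thesis
      by (simp add: erase_def restrict_word_def path.path_eps)
  qed
qed (simp add: restrict_word_def path.path_refl)

text \<open>Every transition of the projected automaton has a preimage in \<open>A\<close>; the
  labels of the preimages along the path spell \<open>r'\<close>.\<close>

lemma path_project_vsaD:
  assumes "path (project_vsa Y A) q r p"
  shows "\<exists>r'. path A q r' p \<and> r = restrict_word Y r'"
  using assms
proof induction
  case (path_refl q)
  have "path A q [] q \<and> [] = restrict_word Y []"
    by (simp add: path.path_refl restrict_word_def)
  then show ?case ..
next
  case (path_eps q p r q')
  then obtain l r' where l: "(q, l, p) \<in> transitions A" "erase Y l = None"
    and r': "path A p r' q'" "r = restrict_word Y r'"
    by (auto simp: transitions_project_vsa)
  show ?case
  proof (cases l)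
    case None
    with l r' show ?thesis by (blast intro: path.path_eps)
  next
    \<comment> \<open>A symbol erased to \<open>None\<close> lies outside \<open>symbols Y\<close>,
      so the filter drops it.\<close>
    case (Some \<gamma>)
    with l(2) have "restrict_word Y (\<gamma> # r') = r"
      by (simp add: erase_def restrict_word_def r'(2) split: if_splits)
    with l(1) Some r'(1) show ?thesis by (blast intro: path.path_sym)
  qed
next
  case (path_sym q \<gamma> p r q')
  then obtain l r' where l: "(q, l, p) \<in> transitions A" "erase Y l = Some \<gamma>"
    and r': "path A p r' q'" "r = restrict_word Y r'"
    by (fastforce simp: transitions_project_vsa)
  from l(2) have "l = Some \<gamma>" and "\<gamma> \<in> symbols Y"
    by (auto simp: erase_def bind_eq_Some_conv split: if_splits)
  then have "path A q (\<gamma> # r') q'" and "\<gamma> # r = restrict_word Y (\<gamma> # r')"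
    using l(1) r' by (auto simp: restrict_word_def intro: path.path_sym)
  then show ?case by blast
qed

lemma ref_words_project_vsa: "ref_words (project_vsa Y A) = restrict_word Y ` ref_words A"
  by (auto simp: ref_words_def dest: path_project_vsaD intro: path_project_vsa)

lemma functional_project_vsa:
  assumes "functional A" and "Y \<subseteq> vars A"
  shows "functional (project_vsa Y A)"
  using assms by (auto simp: functional_def ref_words_project_vsa intro: valid_restrict_word)

lemma spanner_of_functional:
  "functional A \<Longrightarrow> spanner_of A = \<lparr>spanner_vars = vars A,
     tuples_on = \<lambda>s. ref_tuple (vars A) ` {r \<in> ref_words A. clr r = s}\<rparr>"
  by (auto simp: spanner_of_def functional_def fun_eq_iff)

text \<open>Functionality is essential: a ref-word invalid only because of variables outside
  \<open>Y\<close> would become valid by erasure and could add a tuple.\<close>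

lemma spanner_of_project_vsa:
  assumes "functional A" and "Y \<subseteq> vars A"
  shows "spanner_of (project_vsa Y A) = project Y (spanner_of A)"
proof -
  have eq: "ref_tuple Y (restrict_word Y r) = ref_tuple (vars A) r |` Y" if "r \<in> ref_words A" for r
    using that assms by (auto simp: functional_def intro: ref_tuple_restrict_word)
  \<comment> \<open>The condition on \<open>clr\<close> passes through the image since
    \<open>restrict_word\<close> preserves \<open>clr\<close>.\<close>
  have "ref_tuple Y ` {r \<in> restrict_word Y ` ref_words A. clr r = s} =
      (\<lambda>\<mu>. \<mu> |` Y) ` ref_tuple (vars A) ` {r \<in> ref_words A. clr r = s}" for s
    by (force simp: eq[symmetric] image_image)
  then show ?thesis
    using assms
    by (simp add: spanner_of_functional functional_project_vsa project_def ref_words_project_vsa)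
qed

section \<open>The machine\<close>

text \<open>An upper bound on the steps, so that branches of different lengths share one
  statement.\<close>

definition reaches :: "nat \<Rightarrow> program \<Rightarrow> nat \<Rightarrow> config \<Rightarrow> config \<Rightarrow> bool" where
  "reaches B p n c c' \<longleftrightarrow> (\<exists>t\<le>n. run B p t c = Some c')"

lemma run_add: "run B p (s + t) c = Option.bind (run B p s c) (run B p t)"
proof (induction s arbitrary: c)
  case (Suc s)
  show ?case by (cases "exec B (p ! pc c) c") (auto simp: Suc)
qed simp

lemma reaches_trans:
  assumes "reaches B p m c c'" and "reaches B p n c' c''" and "m + n \<le> k"
  shows "reaches B p k c c''"
proof -
  from assms(1,2) obtain s t where "s \<le> m" "run B p s c = Some c'" "t \<le> n" "run B p t c' = Some c''"
    by (auto simp: reaches_def)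
  then have "run B p (s + t) c = Some c''" "s + t \<le> k"
    using assms(3) by (auto simp: run_add)
  then show ?thesis by (auto simp: reaches_def)
qed

lemma reachesI: "run B p n c = Some c' \<Longrightarrow> reaches B p n c c'"
  by (auto simp: reaches_def)

lemma run_numeral:
  "run B p (numeral k) c =
     (if halted p c then None else Option.bind (exec B (p ! pc c) c) (run B p (pred_numeral k)))"
  by (simp add: numeral_eq_Suc)

text \<open>Cells 0, 1 and 2 hold the constants 0, 1 and 10, cell 3 is a loop counter, cells 4 to 7 are
  scratch, and cell \<open>10 + v\<close> holds 1 iff \<open>v\<close> is the code of a variable in \<open>Y\<close>. Since cell 1
  holds 1, \<open>JumpPos 1\<close> is an unconditional jump.\<close>

definition projector :: program where
  "projector =
    [Const 1 1, Const 2 10, Read 3, Write 3,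
     \<comment> \<open>4: copy and mark \<open>Y\<close>\<close>
     JumpPos 3 6, JumpPos 1 12,
     Read 4, Write 4, Add 5 2 4, Store 5 1, Sub 3 3 1, JumpPos 1 4,
     \<comment> \<open>12: skip the variables of the given automaton\<close>
     Read 3,
     JumpPos 3 15, JumpPos 1 18, Read 4, Sub 3 3 1, JumpPos 1 13,
     \<comment> \<open>18: copy the states\<close>
     Read 3, Write 3,
     JumpPos 3 22, JumpPos 1 26, Read 4, Write 4, Sub 3 3 1, JumpPos 1 20,
     \<comment> \<open>26: copy the initial and the final state\<close>
     Read 4, Write 4, Read 4, Write 4,
     \<comment> \<open>30: relabel the transitions\<close>
     Read 3, Write 3,
     JumpPos 3 34, JumpPos 1 52,
     Read 4, Write 4, Read 4, Read 5, Sub 6 4 1, JumpPos 6 43,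
     Write 4, Write 5, JumpPos 1 48,
     Add 6 2 5, Load 7 6, JumpPos 7 40, Write 0, Write 0,
     Read 4, Write 4, Sub 3 3 1, JumpPos 1 32]"

abbreviation conf :: "nat \<Rightarrow> (nat \<Rightarrow> nat) \<Rightarrow> nat list \<Rightarrow> nat list \<Rightarrow> config" where
  "conf l m i os \<equiv> \<lparr>pc = l, mem = m, inp = i, out = os\<rparr>"

text \<open>The loop invariant. \<open>T\<close> consists of codes, not variables; cells 3 to 9 are
  left free for the counter and scratch values.\<close>

definition marked :: "nat set \<Rightarrow> (nat \<Rightarrow> nat) \<Rightarrow> bool" where
  "marked T m \<longleftrightarrow> m 0 = 0 \<and> m 1 = 1 \<and> m 2 = 10 \<and> (\<forall>v. m (10 + v) = of_bool (v \<in> T))"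

lemma marked_scratch [simp]:
  "3 \<le> i \<Longrightarrow> i < 10 \<Longrightarrow> marked T (m(i := v)) \<longleftrightarrow> marked T m"
  by (auto simp: marked_def)

lemma marked_insert:
  "marked T m \<Longrightarrow> marked (insert v T) (m(10 + v := Suc 0))"
  by (auto simp: marked_def)

lemma markedD: "marked T m \<Longrightarrow> m 0 = 0 \<and> m (Suc 0) = Suc 0 \<and> m 2 = 10"
  by (auto simp: marked_def)

lemma length_projector: "length projector = 52"
  by (simp add: projector_def)

text \<open>Unfolding the program only where an instruction is fetched keeps the terms small during
  symbolic execution.\<close>

lemmas projector_nth = arg_cong[OF projector_def, where f = "\<lambda>p. p ! i" for i]

lemmas execute = run_numeral halted_def length_projector projector_nth assign_def markedD

section \<open>Execution of the individual loops\<close>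

text \<open>The 8 bounds the iterations of 7, 4 and 5 steps of the first three loops; the 2 pays for
  the failed test and the jump out.\<close>

lemma loop_step:
  assumes "run B p t c = Some c'" and "t \<le> 8" and "reaches B p (8 * length vs + 2) c' c''"
  shows "reaches B p (8 * length (v # vs) + 2) c c''"
  by (rule reaches_trans[OF reachesI[OF assms(1)] assms(3)]) (use assms(2) in simp)

text \<open>\<open>T\<close> is general because the marks accumulate during the induction. The table
  address \<open>10 + v\<close> is itself computed as a word, hence the bound on it.\<close>

lemma mark_loop:
  assumes "marked T m" and "m 3 = length vs" and "length vs < B" and "\<forall>v\<in>set vs. 10 + v < B"
    and "1 < B"
  shows "\<exists>m'. marked (T \<union> set vs) m' \<and>
    reaches B projector (8 * length vs + 2) (conf 4 m (vs @ rest) os) (conf 12 m' rest (os @ vs))"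
  using assms
proof (induction vs arbitrary: T m os)
  case Nil
  have "reaches B projector 2 (conf 4 m rest os) (conf 12 m rest os)"
    using Nil by (intro reachesI) (simp add: execute)
  then show ?case using Nil by (auto simp: numeral_2_eq_2)
next
  case (Cons v vs)
  define m' where "m' = m(4 := v, 5 := 10 + v, 10 + v := Suc 0, 3 := length vs)"
  have run: "run B projector 7 (conf 4 m ((v # vs) @ rest) os) = Some (conf 4 m' (vs @ rest) (os @ [v]))"
    using Cons.prems unfolding m'_def by (simp add: execute)
  have "marked (insert v T) m'" "m' 3 = length vs"
    unfolding m'_def using Cons.prems by (simp_all add: marked_insert)
  then obtain m'' where m'': "marked (T \<union> set (v # vs)) m''"
    and r: "reaches B projector (8 * length vs + 2) (conf 4 m' (vs @ rest) (os @ [v])) (conf 12 m'' rest (os @ v # vs))"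
    using Cons.IH[of "insert v T" m' "os @ [v]"] Cons.prems by auto
  show ?case
    by (intro exI[of _ m''] conjI m'' loop_step[OF run _ r]) simp
qed

lemma skip_loop:
  assumes "marked T m" and "m 3 = length vs" and "length vs < B" and "\<forall>v\<in>set vs. v < B"
  shows "\<exists>m'. marked T m' \<and>
    reaches B projector (8 * length vs + 2) (conf 13 m (vs @ rest) os) (conf 18 m' rest os)"
  using assms
proof (induction vs arbitrary: m)
  case Nil
  have "reaches B projector 2 (conf 13 m rest os) (conf 18 m rest os)"
    using Nil by (intro reachesI) (simp add: execute)
  then show ?case using Nil by (auto simp: numeral_2_eq_2)
next
  case (Cons v vs)
  define m' where "m' = m(4 := v, 3 := length vs)"
  have run: "run B projector 4 (conf 13 m ((v # vs) @ rest) os) = Some (conf 13 m' (vs @ rest) os)"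
    using Cons.prems unfolding m'_def by (simp add: execute)
  have "marked T m'" "m' 3 = length vs"
    unfolding m'_def using Cons.prems by simp_all
  then obtain m'' where m'': "marked (T) m''"
    and r: "reaches B projector (8 * length vs + 2) (conf 13 m' (vs @ rest) os) (conf 18 m'' rest os)"
    using Cons.IH[of m'] Cons.prems by auto
  show ?case
    by (intro exI[of _ m''] conjI m'' loop_step[OF run _ r]) simp
qed

lemma copy_loop:
  assumes "marked T m" and "m 3 = length vs" and "length vs < B" and "\<forall>v\<in>set vs. v < B"
  shows "\<exists>m'. marked T m' \<and>
    reaches B projector (8 * length vs + 2) (conf 20 m (vs @ rest) os) (conf 26 m' rest (os @ vs))"
  using assms
proof (induction vs arbitrary: m os)
  case Nil
  have "reaches B projector 2 (conf 20 m rest os) (conf 26 m rest os)"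
    using Nil by (intro reachesI) (simp add: execute)
  then show ?case using Nil by (auto simp: numeral_2_eq_2)
next
  case (Cons v vs)
  define m' where "m' = m(4 := v, 3 := length vs)"
  have run: "run B projector 5 (conf 20 m ((v # vs) @ rest) os) = Some (conf 20 m' (vs @ rest) (os @ [v]))"
    using Cons.prems unfolding m'_def by (simp add: execute)
  have "marked T m'" "m' 3 = length vs"
    unfolding m'_def using Cons.prems by simp_all
  then obtain m'' where m'': "marked (T) m''"
    and r: "reaches B projector (8 * length vs + 2) (conf 20 m' (vs @ rest) (os @ [v])) (conf 26 m'' rest (os @ v # vs))"
    using Cons.IH[of m' "os @ [v]"] Cons.prems by auto
  show ?case
    by (intro exI[of _ m''] conjI m'' loop_step[OF run _ r]) simp
qed

text \<open>Truncated subtraction of 1 sends exactly the kinds 0 and 1 (\<open>\<epsilon>\<close>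
  and letters) to 0, and these are copied. For kinds 2 and 3 the table decides between copying and
  writing two zeros, the code of \<open>None\<close>.\<close>

lemma relabel_transition:
  assumes "marked (cv ` Y) m" and "m 3 = Suc n" and "10 < B" and "Suc n < B"
    and "\<forall>w\<in>set (transition_code cq cv ca (q, l, q')). 10 + w < B"
    and "inj_on cv V" and "Y \<subseteq> V" and "l \<in> labels V"
  shows "\<exists>m'. marked (cv ` Y) m' \<and> m' 3 = n \<and>
    reaches B projector 17 (conf 32 m (transition_code cq cv ca (q, l, q') @ rest) os)
      (conf 32 m' rest (os @ transition_code cq cv ca (q, erase Y l, q')))"
    (is "\<exists>m'. _ \<and> _ \<and> reaches _ _ _ ?c (?c' m')")
proof -
  \<comment> \<open>Injectivity of \<open>cv\<close> on \<open>V\<close> excludes that a variable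
    outside \<open>Y\<close> shares a marked code.\<close>
  have table: "m (10 + cv x) = of_bool (x \<in> Y)" if "x \<in> V" for x
    using that assms(1,6,7) by (auto simp: marked_def inj_on_def)
  \<comment> \<open>Each branch supplies its exact \<open>t\<close>; symbolic execution then yields
    an equation that determines \<open>m'\<close>.\<close>
  have "\<exists>t m'. t \<le> 17 \<and> marked (cv ` Y) m' \<and> m' 3 = n \<and> run B projector t ?c = Some (?c' m')"
  proof (cases l)
    case None
    then show ?thesis using assms
      by (intro exI[of _ 14]) (simp add: execute erase_def)
  next
    case (Some \<gamma>)
    have op: ?thesis if "\<gamma> = Open x \<or> \<gamma> = Close x" for x
    proof -
      have x: "x \<in> V" using that Some assms(8) by (auto simp: labels_def var_ops_def)
      show ?thesis
      proof (cases "x \<in> Y")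
        case True
        with table[OF x] that Some assms show ?thesis
          by (intro exI[of _ 17]) (auto simp: execute erase_def)
      next
        case False
        with table[OF x] that Some assms show ?thesis
          by (intro exI[of _ 16]) (auto simp: execute erase_def)
      qed
    qed
    show ?thesis
    proof (cases \<gamma>)
      case (Letter a)
      then show ?thesis using Some assms
        by (intro exI[of _ 14]) (simp add: execute erase_def)
    qed (use op in auto)
  qed
  then show ?thesis by (auto simp: reaches_def)
qed

text \<open>The transitions come last, so the tape ends up empty; 52 is the length of the program,
  so the machine has halted.\<close>

lemma relabel_loop:
  assumes "marked (cv ` Y) m" and "m 3 = length ts" and "10 < B" and "length ts < B"
    and "\<forall>w\<in>set (concat (map (transition_code cq cv ca) ts)). 10 + w < B"
    and "inj_on cv V" and "Y \<subseteq> V" and "\<forall>(q, l, q')\<in>set ts. l \<in> labels V"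
  shows "\<exists>m'. reaches B projector (17 * length ts + 2)
    (conf 32 m (concat (map (transition_code cq cv ca) ts)) os)
    (conf 52 m' [] (os @ concat (map (transition_code cq cv ca)
      (map (\<lambda>(q, l, q'). (q, erase Y l, q')) ts))))"
  using assms
proof (induction ts arbitrary: m os)
  case Nil
  have "reaches B projector 2 (conf 32 m [] os) (conf 52 m [] os)"
    using Nil by (intro reachesI) (simp add: execute)
  then show ?case by (auto simp: numeral_2_eq_2)
next
  case (Cons t ts)
  obtain q l q' where t: "t = (q, l, q')" by (cases t)
  let ?code = "transition_code cq cv ca"
  obtain m' where m': "marked (cv ` Y) m'" "m' 3 = length ts"
    and r: "reaches B projector 17 (conf 32 m (?code t @ concat (map ?code ts)) os)
      (conf 32 m' (concat (map ?code ts)) (os @ ?code (q, erase Y l, q')))"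
    using relabel_transition[of cv Y m "length ts" B cq ca q l q' V "concat (map ?code ts)" os] Cons.prems
    unfolding t by auto
  obtain m'' where "reaches B projector (17 * length ts + 2)
    (conf 32 m' (concat (map ?code ts)) (os @ ?code (q, erase Y l, q')))
    (conf 52 m'' [] ((os @ ?code (q, erase Y l, q')) @ concat (map ?code
      (map (\<lambda>(q, l, q'). (q, erase Y l, q')) ts))))"
    using Cons.IH[OF m', of "os @ ?code (q, erase Y l, q')"] Cons.prems
    by (auto simp del: transition_code.simps)
  with r have "reaches B projector (17 * length (t # ts) + 2)
    (conf 32 m (?code t @ concat (map ?code ts)) os)
    (conf 52 m'' [] ((os @ ?code (q, erase Y l, q')) @ concat (map ?code
      (map (\<lambda>(q, l, q'). (q, erase Y l, q')) ts))))"
    by (rule reaches_trans) simp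
  then show ?case by (auto simp: t simp del: transition_code.simps)
qed

section \<open>Total running time and word size\<close>

lemma length_concat_transition_codes:
  "length (concat (map (transition_code cq cv ca) ts)) = 4 * length ts"
proof -
  have "length (transition_code cq cv ca t) = 4" for t
    by (cases "(cv, ca, fst (snd t))" rule: label_code.cases) (cases t; simp)+
  then show ?thesis by (induction ts) simp_all
qed

text \<open>The phases take at most 21 steps plus 8 per listed variable or state and 17 per
  transition. The input has 6 further words, one per variable or state, and 4 per transition, so
  \<open>25 * length x\<close> suffices.\<close>

lemma reaches_projector:
  assumes x: "x = length ys # map cv ys @ length vs # map cv vs @ length qs # map cq qs @
      [i, f] @ length ts # concat (map (transition_code cq cv ca) ts)"
    and B: "\<forall>w\<in>set x. 10 + w < B" and "inj_on cv V" and "set ys \<subseteq> V"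
    and "\<forall>(q, l, q')\<in>set ts. l \<in> labels V"
  shows "\<exists>m. reaches B projector (25 * length x) (start x)
    (conf 52 m [] (length ys # map cv ys @ length qs # map cq qs @ [i, f] @
      length ts # concat (map (transition_code cq cv ca)
        (map (\<lambda>(q, l, q'). (q, erase (set ys) l, q')) ts))))"
proof -
  let ?code = "transition_code cq cv ca"
  let ?x4 = "concat (map ?code ts)"
  let ?x3 = "i # f # length ts # ?x4"
  let ?x2 = "map cq qs @ ?x3"
  let ?x1 = "map cv vs @ length qs # ?x2"
  let ?o1 = "length ys # map cv ys"
  let ?o2 = "?o1 @ length qs # map cq qs"
  have lengths: "10 + length ys < B" "10 + length vs < B" "10 + length qs < B" "10 + length ts < B"
      "i < B" "f < B"
    using B x by auto
  from B have B': "\<forall>w\<in>set x. w < B" by fastforce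
  have words: "(\<forall>v\<in>set (map cv ys). 10 + v < B) \<and> (\<forall>v\<in>set (map cv vs). v < B) \<and>
      (\<forall>v\<in>set (map cq qs). v < B) \<and> (\<forall>w\<in>set ?x4. 10 + w < B)"
    using B B' unfolding x by simp
  \<comment> \<open>Memory after the first four instructions; the zero memory is the table of the
    empty set.\<close>
  define m0 :: "nat \<Rightarrow> nat" where "m0 = (\<lambda>_. 0)(1 := 1, 2 := 10, 3 := length ys)"
  have m0: "marked {} m0" "m0 3 = length ys"
    by (auto simp: m0_def marked_def)
  have "run B projector 4 (start x) = Some (conf 4 m0 (map cv ys @ length vs # ?x1) [length ys])"
    using lengths by (simp add: execute start_def m0_def x)
  then have r0: "reaches B projector 4 (start x) (conf 4 m0 (map cv ys @ length vs # ?x1) [length ys])"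
    by (rule reachesI)
  obtain m1 where m1: "marked (cv ` set ys) m1"
    and r1: "reaches B projector (8 * length ys + 2)
      (conf 4 m0 (map cv ys @ length vs # ?x1) [length ys]) (conf 12 m1 (length vs # ?x1) ?o1)"
    using mark_loop[OF m0(1), of "map cv ys" B "length vs # ?x1" "[length ys]"] m0 lengths words by auto
  have r2: "reaches B projector 1 (conf 12 m1 (length vs # ?x1) ?o1)
      (conf 13 (m1(3 := length vs)) ?x1 ?o1)"
    using lengths by (intro reachesI) (simp add: execute)
  obtain m2 where m2: "marked (cv ` set ys) m2"
    and r3: "reaches B projector (8 * length vs + 2) (conf 13 (m1(3 := length vs)) ?x1 ?o1)
      (conf 18 m2 (length qs # ?x2) ?o1)"
    using skip_loop[of "cv ` set ys" "m1(3 := length vs)" "map cv vs" B "length qs # ?x2" ?o1] m1 lengths words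
    by auto
  have r4: "reaches B projector 2 (conf 18 m2 (length qs # ?x2) ?o1)
      (conf 20 (m2(3 := length qs)) ?x2 (?o1 @ [length qs]))"
    using lengths by (intro reachesI) (simp add: execute)
  obtain m3 where m3: "marked (cv ` set ys) m3"
    and r5: "reaches B projector (8 * length qs + 2) (conf 20 (m2(3 := length qs)) ?x2 (?o1 @ [length qs]))
      (conf 26 m3 ?x3 ?o2)"
    using copy_loop[of "cv ` set ys" "m2(3 := length qs)" "map cq qs" B ?x3 "?o1 @ [length qs]"] m2 lengths words
    by auto
  have r6: "reaches B projector 6 (conf 26 m3 ?x3 ?o2)
      (conf 32 (m3(4 := f, 3 := length ts)) ?x4 (?o2 @ [i, f, length ts]))"
    using lengths by (intro reachesI) (simp add: execute)
  obtain m4 where r7: "reaches B projector (17 * length ts + 2)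
      (conf 32 (m3(4 := f, 3 := length ts)) ?x4 (?o2 @ [i, f, length ts]))
      (conf 52 m4 [] ((?o2 @ [i, f, length ts]) @ concat (map ?code
        (map (\<lambda>(q, l, q'). (q, erase (set ys) l, q')) ts))))"
    using relabel_loop[of cv "set ys" "m3(4 := f, 3 := length ts)" ts B cq ca V "?o2 @ [i, f, length ts]"]
      m3 lengths words assms(3-5)
    by auto
  \<comment> \<open>The inner compositions keep exact sums as bounds, so only the outermost one
    needs arithmetic.\<close>
  note r = reaches_trans[OF _ _ order_refl]
  have "reaches B projector (25 * length x) (start x)
      (conf 52 m4 [] ((?o2 @ [i, f, length ts]) @ concat (map ?code
        (map (\<lambda>(q, l, q'). (q, erase (set ys) l, q')) ts))))"
    by (rule reaches_trans[OF r[OF r[OF r[OF r[OF r[OF r[OF r0 r1] r2] r3] r4] r5] r6] r7])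
      (simp add: x length_concat_transition_codes)
  then show ?thesis by auto
qed

text \<open>As \<open>n + 2\<close> is at least 4, two more exponents give a factor of at least 16,
  which leaves room for the table offset 10.\<close>

lemma word_bound_offset:
  assumes "w < word_bound k n" and "2 \<le> n"
  shows "10 + w < word_bound (k + 2) n"
proof -
  have "4 * 4 \<le> (n + 2) * (n + 2)"
    using assms(2) by (intro mult_le_mono) auto
  then have "(n + 2) ^ k * 16 \<le> (n + 2) ^ k * ((n + 2) * (n + 2))"
    by (intro mult_le_mono2) simp
  moreover have "1 \<le> (n + 2) ^ k" by simp
  ultimately have "10 + (n + 2) ^ k < (n + 2) ^ k * ((n + 2) * (n + 2))" by linarith
  with assms(1) have "10 + w < (n + 2) ^ k * ((n + 2) * (n + 2))"
    unfolding word_bound_def by linarith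
  then show ?thesis
    unfolding word_bound_def by (simp only: power_add power2_eq_square)
qed

theorem lemma3p8:
  fixes ca :: "'a::finite \<Rightarrow> nat" and k :: nat
  assumes "card (UNIV :: 'a set) \<ge> 2"
    and "infinite (UNIV :: 'v set)"
    and "inj ca"
  shows "\<exists>p c d. \<forall>(A :: ('q, 'a, 'v) vsa) Y cq cv x.
    vset_automaton A \<and> functional A \<and> Y \<subseteq> vars A \<and>
    inj_on cq (states A) \<and> inj_on cv (vars A) \<and>
    x \<in> projection_input_code cq cv ca A Y \<and>
    (\<forall>w\<in>set x. w < word_bound k (length x)) \<longrightarrow>
    (\<exists>(A\<^sub>Y :: ('q, 'a, 'v) vsa) cq' y t.
      computes (word_bound d (length x)) p x t y \<and> t \<le> c * length x \<and>
      inj_on cq' (states A\<^sub>Y) \<and> y \<in> vsa_code cq' cv ca A\<^sub>Y \<and>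
      vset_automaton A\<^sub>Y \<and> functional A\<^sub>Y \<and>
      spanner_of A\<^sub>Y = project Y (spanner_of A))"
\<comment> \<open>The witnesses stay schematic until the final \<open>show\<close> fixes them as
  \<open>projector\<close>, 25 and \<open>k + 2\<close>; only the word size depends on
  \<open>k\<close>.\<close>
proof ((rule exI)+, intro allI impI, elim conjE)
  fix A :: "('q, 'a, 'v) vsa" and Y cq cv x
  assume A: "vset_automaton A" "functional A" and Y: "Y \<subseteq> vars A"
    and inj: "inj_on cq (states A)" "inj_on cv (vars A)"
    and "x \<in> projection_input_code cq cv ca A Y"
    and bound: "\<forall>w\<in>set x. w < word_bound k (length x)"
  then obtain ys vs qs ts where
    sets: "set ys = Y" "set vs = vars A" "set qs = states A" "set ts = transitions A"
    and x: "x = length ys # map cv ys @ length vs # map cv vs @ length qs # map cq qs @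
      [cq (init A), cq (final A)] @ length ts # concat (map (transition_code cq cv ca) ts)"
    by (auto simp: projection_input_code_def vsa_code_def set_code_def)
  let ?y = "length ys # map cv ys @ length qs # map cq qs @ [cq (init A), cq (final A)] @
      length ts # concat (map (transition_code cq cv ca)
        (map (\<lambda>(q, l, q'). (q, erase Y l, q')) ts))"
  have "2 \<le> length x" by (simp add: x)
  with bound have "\<forall>w\<in>set x. 10 + w < word_bound (k + 2) (length x)"
    by (blast intro: word_bound_offset)
  moreover have "\<forall>(q, l, q')\<in>set ts. l \<in> labels (vars A)"
    by (auto simp: sets transitions_def)
  ultimately obtain m where "reaches (word_bound (k + 2) (length x)) projector (25 * length x)
      (start x) (conf 52 m [] ?y)"
    using reaches_projector[OF x _ inj(2)] Y sets(1) by blast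
  then obtain t where "t \<le> 25 * length x"
    and "computes (word_bound (k + 2) (length x)) projector x t ?y"
    by (auto simp: reaches_def computes_def halted_def length_projector)
  moreover have "?y \<in> vsa_code cq cv ca (project_vsa Y A)"
  proof -
    have "length ys # map cv ys \<in> set_code (\<lambda>x. [cv x]) (vars (project_vsa Y A))"
      unfolding set_code_def using sets by (auto intro!: exI[of _ ys])
    moreover have "length qs # map cq qs \<in> set_code (\<lambda>q. [cq q]) (states (project_vsa Y A))"
      unfolding set_code_def using sets by (auto intro!: exI[of _ qs])
    \<comment> \<open>Relabelling may make transitions coincide. Since \<open>set_code\<close>
      admits repetitions, the count \<open>length ts\<close> can be copied unchanged.\<close>
    moreover have "length ts # concat (map (transition_code cq cv ca)
        (map (\<lambda>(q, l, q'). (q, erase Y l, q')) ts))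
        \<in> set_code (transition_code cq cv ca) (transitions (project_vsa Y A))"
      unfolding set_code_def transitions_project_vsa sets(4)[symmetric]
      by (rule CollectI, rule exI[of _ "map (\<lambda>(q, l, q'). (q, erase Y l, q')) ts"]) simp
    ultimately show ?thesis
      unfolding vsa_code_def
      by (intro CollectI exI[of _ "length ys # map cv ys"] exI[of _ "length qs # map cq qs"]
        exI[of _ "length ts # concat (map (transition_code cq cv ca)
          (map (\<lambda>(q, l, q'). (q, erase Y l, q')) ts))"]) (simp del: map_map)
  qed
  ultimately show "\<exists>(A\<^sub>Y :: ('q, 'a, 'v) vsa) cq' y t.
      computes (word_bound (k + 2) (length x)) projector x t y \<and> t \<le> 25 * length x \<and>
      inj_on cq' (states A\<^sub>Y) \<and> y \<in> vsa_code cq' cv ca A\<^sub>Y \<and>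
      vset_automaton A\<^sub>Y \<and> functional A\<^sub>Y \<and>
      spanner_of A\<^sub>Y = project Y (spanner_of A)"
    using vset_automaton_project_vsa[OF A(1) Y] functional_project_vsa[OF A(2) Y]
      spanner_of_project_vsa[OF A(2) Y] inj(1)
    by (intro exI[of _ "project_vsa Y A"] exI[of _ cq] exI[of _ ?y] exI[of _ t]) simp
qed

end
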